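(* Let $c,n$ be integers with $1\le c<n$. For any subset $\Gamma$ of $\{1,2,\dots,n\}$ with $|\Gamma|=c$, we have $$p(\Gamma,n)\le p(\{1,2,\dots,c\},n)=p(\{n-c+1,\dots,n\},n).$$
   Context: Setting: $(R_1,\dots,R_n)$ is a uniformly random permutation of $(1,2,\dots,n)$ ($R_j$ is the absolute rank of the $j$-th candidate, rank 1 being the best), and $X_j=|\{1\le i\le j: R_i\le R_j\}|$ is the relative rank of the $j$-th candidate among the first $j$. $\mathcal{F}_j$ is the $\sigma$-algebra generated by $X_1,\dots,X_j$, and $\mathcal{M}_n$ is the set of all stopping rules with values in $\{1,\dots,n\}$ adapted to $\{\mathcal{F}_j\}$. For $\Gamma\subseteq\{1,\dots,n\}$, $$p(\Gamma,n):=\sup_{\tau\in\mathcal{M}_n}P(R_\tau\in\Gamma),$$ the maximum probability of selecting a candidate whose absolute rank belongs to $\Gamma$. *)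

theory Defs
  imports "HOL-Probability.Probability" "HOL-Combinatorics.Permutations"
begin

text \<open>A sample point is a permutation \<open>R\<close> of \<open>{1..n}\<close>, where \<open>R j\<close> is the absolute rank of the
  \<open>j\<close>-th candidate (rank 1 is best).  Functions with \<open>R permutes {1..n}\<close> are the identity outside
  \<open>{1..n}\<close>, so each permutation is counted exactly once.\<close>

definition rank_space :: "nat \<Rightarrow> (nat \<Rightarrow> nat) measure" where
  "rank_space n = uniform_count_measure {R. R permutes {1..n}}"

definition relative_rank :: "nat \<Rightarrow> (nat \<Rightarrow> nat) \<Rightarrow> nat" where
  "relative_rank j R = card {i \<in> {1..j}. R i \<le> R j}"

text \<open>The \<open>\<sigma>\<close>-algebra generated by the first \<open>j\<close> relative ranks.  It is trivial for \<open>j = 0\<close>; indices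
  \<open>j > n\<close>, which play no role for stopping rules bounded by \<open>n\<close>, add no information.\<close>

definition rank_filtration :: "nat \<Rightarrow> nat \<Rightarrow> (nat \<Rightarrow> nat) measure" where
  "rank_filtration n j = sigma (space (rank_space n))
     {relative_rank i -` A \<inter> space (rank_space n) | i A. i \<in> {1..j}}"

definition stopping_rules :: "nat \<Rightarrow> ((nat \<Rightarrow> nat) \<Rightarrow> nat) set" where
  "stopping_rules n =
     {\<tau> \<in> space (rank_space n) \<rightarrow> {1..n}. stopping_time (rank_filtration n) \<tau>}"

definition max_select_prob :: "nat set \<Rightarrow> nat \<Rightarrow> real" where
  "max_select_prob \<Gamma> n =
     (SUP \<tau>\<in>stopping_rules n. measure (rank_space n) {R \<in> space (rank_space n). R (\<tau> R) \<in> \<Gamma>})"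

text \<open>For \<open>n \<ge> 1\<close> the supremum is over a nonempty set bounded above, so the conditionally complete \<open>SUP\<close> on
  the reals is the true supremum.\<close>

lemma prob_space_rank_space: "prob_space (rank_space n)"
  unfolding rank_space_def
  by (rule prob_space_uniform_count_measure) (auto simp: finite_permutations intro: permutes_id)

lemma filtration_rank: "filtration (space (rank_space n)) (rank_filtration n)"
proof
  show "space (rank_filtration n i) = space (rank_space n)" for i
    unfolding rank_filtration_def by (intro space_measure_of) auto
  show "sets (rank_filtration n i) \<le> sets (rank_filtration n j)" if "i \<le> j" for i j
    unfolding rank_filtration_def using that
    by (subst (1 2) sets_measure_of, blast, blast, intro sigma_sets_mono') fastforce
qed

lemma stopping_rules_nonempty: "n \<ge> 1 \<Longrightarrow> stopping_rules n \<noteq> {}"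
  unfolding stopping_rules_def using stopping_time_const[of "rank_filtration n" 1] by force

lemma bdd_above_select_prob:
  "bdd_above ((\<lambda>\<tau>. measure (rank_space n) {R \<in> space (rank_space n). R (\<tau> R) \<in> \<Gamma>}) ` T)"
  using prob_space.prob_le_1[OF prob_space_rank_space] by (intro bdd_aboveI[of _ 1]) auto

end

theory Submission
  imports Defs
begin

text \<open>Given \<open>X\<^sub>1, \<dots>, X\<^sub>j\<close>, the probability \<open>q\<^sub>j(X\<^sub>j)\<close> that \<open>R\<^sub>j \<in> \<Gamma>\<close> depends on \<open>X\<^sub>j\<close> only, and \<open>X\<^sub>j\<close> is uniform
  on \<open>{1..j}\<close> and independent of the past.  Hence the value of the stopping problem is \<open>v\<^sub>0\<close>, where
  \<open>v\<^sub>n = 0\<close> and \<open>v\<^sub>j\<^sub>-\<^sub>1\<close> is the mean of \<open>max (q\<^sub>j(y)) v\<^sub>j\<close> over \<open>y \<in> {1..j}\<close>.  For each \<open>j\<close> the vector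
  \<open>q\<^sub>j\<close> of \<open>\<Gamma>\<close> is majorized by that of \<open>{1..c}\<close>: this is clear for \<open>j = n\<close> and is preserved by the
  backward recursion for \<open>q\<^sub>j\<close>.  The mean of \<open>max (q\<^sub>j(y)) v\<close> is monotone under majorization and
  in \<open>v\<close>, which gives the inequality.  The equality holds because reversing the ranks only permutes
  the entries of each \<open>q\<^sub>j\<close>.\<close>

section \<open>Relative ranks\<close>

text \<open>Interpolates between the relative rank of candidate \<open>i\<close> at
  \<open>j = i\<close> and its absolute rank at \<open>j = n\<close>.\<close>

definition prefix_rank :: "nat \<Rightarrow> nat \<Rightarrow> (nat \<Rightarrow> nat) \<Rightarrow> nat" where
  "prefix_rank j i R = card {k \<in> {1..j}. R k \<le> R i}"

lemma relative_rank_eq_prefix_rank: "relative_rank j R = prefix_rank j j R"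
  by (simp add: relative_rank_def prefix_rank_def)

lemma relative_rank_range:
  assumes "1 \<le> j"
  shows "relative_rank j R \<in> {1..j}"
proof -
  have "j \<in> {i \<in> {1..j}. R i \<le> R j}" using assms by simp
  then have "relative_rank j R \<noteq> 0" unfolding relative_rank_def by (auto simp: card_eq_0_iff)
  moreover have "relative_rank j R \<le> card {1..j}"
    unfolding relative_rank_def by (intro card_mono) auto
  ultimately show ?thesis by simp
qed

lemma prefix_rank_full:
  assumes R: "R permutes {1..n}" and i: "i \<in> {1..n}"
  shows "prefix_rank n i R = R i"
proof -
  have Ri: "R i \<in> {1..n}" using permutes_in_image[OF R] i by blast
  have "R ` {k \<in> {1..n}. R k \<le> R i} = {y \<in> R ` {1..n}. y \<le> R i}" by auto
  also have "\<dots> = {1..R i}" unfolding permutes_image[OF R] using Ri by auto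
  finally have "card (R ` {k \<in> {1..n}. R k \<le> R i}) = R i" by simp
  then show ?thesis
    using card_image[OF permutes_inj_on[OF R]] unfolding prefix_rank_def by metis
qed

text \<open>The newcomer beats candidate \<open>i\<close> exactly when its relative rank is at most
  the old rank of \<open>i\<close>, and only then does that rank grow.\<close>

lemma prefix_rank_Suc:
  assumes R: "inj R" and i: "1 \<le> i" "i \<le> j"
  shows "prefix_rank (Suc j) i R
    = prefix_rank j i R + (if relative_rank (Suc j) R \<le> prefix_rank j i R then 1 else 0)"
proof -
  have ne: "R (Suc j) \<noteq> R i" using inj_eq[OF R] i by simp
  have rr: "relative_rank (Suc j) R = Suc (card {k \<in> {1..j}. R k \<le> R (Suc j)})"
  proof -
    have "{k \<in> {1..Suc j}. R k \<le> R (Suc j)} = insert (Suc j) {k \<in> {1..j}. R k \<le> R (Suc j)}"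
      by (auto simp: le_Suc_eq)
    then show ?thesis unfolding relative_rank_def by simp
  qed
  show ?thesis
  proof (cases "R (Suc j) < R i")
    case True
    have "{k \<in> {1..Suc j}. R k \<le> R i} = insert (Suc j) {k \<in> {1..j}. R k \<le> R i}"
      using True by (auto simp: le_Suc_eq)
    then have 1: "prefix_rank (Suc j) i R = Suc (prefix_rank j i R)"
      unfolding prefix_rank_def by simp
    \<comment> \<open>Candidate \<open>i\<close> is counted for itself but not for the newcomer;
      this extra element matches the \<open>Suc\<close> in \<open>rr\<close>.\<close>
    have "insert i {k \<in> {1..j}. R k \<le> R (Suc j)} \<subseteq> {k \<in> {1..j}. R k \<le> R i}"
      using True i by auto
    then have "card (insert i {k \<in> {1..j}. R k \<le> R (Suc j)}) \<le> prefix_rank j i R"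
      unfolding prefix_rank_def by (intro card_mono) auto
    then show ?thesis using 1 rr True by simp
  next
    case False
    then have lt: "R i < R (Suc j)" using ne by simp
    then have "{k \<in> {1..Suc j}. R k \<le> R i} = {k \<in> {1..j}. R k \<le> R i}"
      by (auto simp: le_Suc_eq)
    then have 1: "prefix_rank (Suc j) i R = prefix_rank j i R"
      unfolding prefix_rank_def by simp
    have "prefix_rank j i R \<le> card {k \<in> {1..j}. R k \<le> R (Suc j)}"
      unfolding prefix_rank_def using lt by (intro card_mono) auto
    then show ?thesis using 1 rr by simp
  qed
qed

text \<open>Starting from the relative rank of \<open>i\<close>, the later relative ranks determine
  each update of its rank, up to the absolute rank at level \<open>n\<close>.\<close>

lemma relative_ranks_inj:
  assumes R: "R permutes {1..n}" and R': "R' permutes {1..n}"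
    and eq: "\<And>i. i \<in> {1..n} \<Longrightarrow> relative_rank i R = relative_rank i R'"
  shows "R = R'"
proof
  fix i
  show "R i = R' i"
  proof (cases "i \<in> {1..n}")
    case True
    have "prefix_rank j i R = prefix_rank j i R'" if "i \<le> j" "j \<le> n" for j
      using that
    proof (induction j rule: dec_induct)
      case base
      then show ?case using eq[OF True] by (simp add: relative_rank_eq_prefix_rank)
    next
      case (step j)
      then show ?case
        using True eq[of "Suc j"] prefix_rank_Suc[OF permutes_inj[OF R]]
          prefix_rank_Suc[OF permutes_inj[OF R']] by simp
    qed
    then show ?thesis
      using True prefix_rank_full[OF R True] prefix_rank_full[OF R' True] by simp
  next
    case False
    then show ?thesis using R R' by (simp add: permutes_not_in)
  qed
qed

section \<open>Permutations with prescribed initial relative ranks\<close>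

text \<open>When nonempty, these are the atoms of the \<open>j\<close>-th \<sigma>-algebra; level 0
  gives the whole space.\<close>

definition cylinder :: "nat \<Rightarrow> nat \<Rightarrow> (nat \<Rightarrow> nat) \<Rightarrow> (nat \<Rightarrow> nat) set" where
  "cylinder n j x = {R. R permutes {1..n} \<and> (\<forall>i\<in>{1..j}. relative_rank i R = x i)}"

lemma finite_cylinder [simp]: "finite (cylinder n j x)"
  by (rule finite_subset[OF _ finite_permutations[of "{1..n}"]]) (auto simp: cylinder_def)

lemma cylinder_Suc: "R \<in> cylinder n (Suc j) x \<longleftrightarrow> R \<in> cylinder n j x \<and> relative_rank (Suc j) R = x (Suc j)"
  unfolding cylinder_def by (auto simp: le_Suc_eq)

lemma cylinder_upd [simp]: "cylinder n j (x(Suc j := k)) = cylinder n j x"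
  unfolding cylinder_def by auto

lemma card_cylinder_split:
  "card {R \<in> cylinder n j x. P R}
    = (\<Sum>k\<in>{1..Suc j}. card {R \<in> cylinder n (Suc j) (x(Suc j := k)). P R})"
proof -
  have "{R \<in> cylinder n j x. P R}
      = (\<Union>k\<in>{1..Suc j}. {R \<in> cylinder n (Suc j) (x(Suc j := k)). P R})"
    using relative_rank_range[of "Suc j"] by (auto simp: cylinder_Suc)
  also have "card \<dots> = (\<Sum>k\<in>{1..Suc j}. card {R \<in> cylinder n (Suc j) (x(Suc j := k)). P R})"
    by (intro card_UN_disjoint) (auto simp: cylinder_Suc)
  finally show ?thesis .
qed

text \<open>The relative ranks embed the \<open>n!\<close> permutations into a product with
  \<open>n!\<close> elements, so every admissible sequence occurs exactly once. This encodes their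
  independence and uniformity.\<close>

lemma card_cylinder_full:
  assumes "\<And>i. i \<in> {1..n} \<Longrightarrow> x i \<in> {1..i}"
  shows "card (cylinder n n x) = 1"
proof -
  define f where "f R = restrict (\<lambda>i. relative_rank i R) {1..n}" for R
  let ?P = "{R. R permutes {1..n}}" and ?X = "Pi\<^sub>E {1..n} (\<lambda>i. {1..i})"
  have inj: "inj_on f ?P"
  proof (rule inj_onI)
    fix R R' assume "R \<in> ?P" "R' \<in> ?P" and "f R = f R'"
    then show "R = R'" unfolding f_def
      by (intro relative_ranks_inj[of R n R']) (auto dest!: fun_cong split: if_splits)
  qed
  have sub: "f ` ?P \<subseteq> ?X"
    using relative_rank_range unfolding f_def by (fastforce simp: PiE_iff)
  have "card ?X = fact n" by (simp add: card_PiE fact_prod)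
  moreover have "card (f ` ?P) = fact n"
    using card_image[OF inj] card_permutations[of "{1..n}" n] by simp
  ultimately have "f ` ?P = ?X"
    using sub by (intro card_subset_eq) (auto intro: finite_PiE)
  moreover have "restrict x {1..n} \<in> ?X" using assms by auto
  ultimately obtain R where R: "R permutes {1..n}" "f R = restrict x {1..n}"
    by (metis (mono_tags, lifting) imageE mem_Collect_eq)
  have eq: "relative_rank i R = x i" if "i \<in> {1..n}" for i
    using fun_cong[OF R(2), of i] that by (simp add: f_def)
  have "R' = R" if "R' \<in> cylinder n n x" for R'
    using that eq by (intro relative_ranks_inj[OF _ R(1)]) (auto simp: cylinder_def)
  moreover have "R \<in> cylinder n n x" using R(1) eq by (simp add: cylinder_def)
  ultimately have "cylinder n n x = {R}" by blast
  then show ?thesis by simp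
qed

section \<open>Optimal stopping by backward induction\<close>

text \<open>The probability that a candidate with rank \<open>y\<close> among the first \<open>j\<close> has absolute rank in
  \<open>\<Gamma>\<close>: the next candidate raises the rank \<open>y\<close> to \<open>y + 1\<close> with probability \<open>y / (j + 1)\<close>.\<close>

function hit_prob :: "nat \<Rightarrow> nat set \<Rightarrow> nat \<Rightarrow> nat \<Rightarrow> real" where
  "hit_prob n \<Gamma> j y = (if n \<le> j then of_bool (y \<in> \<Gamma>)
     else (real y * hit_prob n \<Gamma> (Suc j) (Suc y)
       + (real (Suc j) - real y) * hit_prob n \<Gamma> (Suc j) y) / real (Suc j))"
  by pat_completeness auto
termination by (relation "Wellfounded.measure (\<lambda>(n, \<Gamma>, j, y). n - j)") auto

text \<open>The optimal success probability when none of the first \<open>j\<close> candidates has been accepted.\<close>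

function stop_value :: "nat \<Rightarrow> nat set \<Rightarrow> nat \<Rightarrow> real" where
  "stop_value n \<Gamma> j = (if n \<le> j then 0
     else (\<Sum>y\<in>{1..Suc j}. max (hit_prob n \<Gamma> (Suc j) y) (stop_value n \<Gamma> (Suc j))) / real (Suc j))"
  by pat_completeness auto
termination by (relation "Wellfounded.measure (\<lambda>(n, \<Gamma>, j). n - j)") auto

declare hit_prob.simps [simp del] stop_value.simps [simp del]

lemma hit_prob_final [simp]: "hit_prob n \<Gamma> n y = of_bool (y \<in> \<Gamma>)"
  by (simp add: hit_prob.simps)

lemma hit_prob_step:
  "j < n \<Longrightarrow> real (Suc j) * hit_prob n \<Gamma> j y = real y * hit_prob n \<Gamma> (Suc j) (Suc y)
       + (real (Suc j) - real y) * hit_prob n \<Gamma> (Suc j) y"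
  by (subst hit_prob.simps) simp

lemma stop_value_final [simp]: "stop_value n \<Gamma> n = 0"
  by (simp add: stop_value.simps)

lemma stop_value_step:
  "j < n \<Longrightarrow> real (Suc j) * stop_value n \<Gamma> j
    = (\<Sum>y\<in>{1..Suc j}. max (hit_prob n \<Gamma> (Suc j) y) (stop_value n \<Gamma> (Suc j)))"
  by (subst stop_value.simps) simp

text \<open>With \<open>m = Suc j\<close> and \<open>k\<close> the newcomer's relative rank, this
  averages over the next candidate as in the recursion for \<open>hit_prob\<close>.\<close>

lemma sum_shift_le:
  fixes f :: "nat \<Rightarrow> real"
  assumes "y \<le> m"
  shows "(\<Sum>k\<in>{1..m}. f (y + (if k \<le> y then 1 else 0))) = real y * f (Suc y) + (real m - real y) * f y"
proof -
  have "{1..m} = {1..y} \<union> {y<..m}" using assms by auto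
  then have "(\<Sum>k\<in>{1..m}. f (y + (if k \<le> y then 1 else 0)))
      = (\<Sum>k\<in>{1..y}. f (y + (if k \<le> y then 1 else 0))) + (\<Sum>k\<in>{y<..m}. f (y + (if k \<le> y then 1 else 0)))"
    by (simp add: sum.union_disjoint ivl_disj_int)
  then show ?thesis using assms by (simp add: of_nat_diff)
qed

text \<open>A cylinder of level \<open>j\<close> has \<open>n! / j!\<close> elements; the counting statements are cleared of the
  denominator.\<close>

lemma card_cylinder_hit:
  assumes "j \<le> n" "1 \<le> i" "i \<le> j"
    and "\<And>k. k \<in> {1..j} \<Longrightarrow> x k \<in> {1..k}"
    and "y \<le> j" and "\<And>R. R \<in> cylinder n j x \<Longrightarrow> prefix_rank j i R = y"
  shows "fact j * real (card {R \<in> cylinder n j x. R i \<in> \<Gamma>}) = fact n * hit_prob n \<Gamma> j y"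
  using assms
proof (induction j arbitrary: x y rule: inc_induct)
  case base
  have "R i = y" if "R \<in> cylinder n n x" for R
    using base that prefix_rank_full[of R n i] by (auto simp: cylinder_def)
  then have "{R \<in> cylinder n n x. R i \<in> \<Gamma>} = (if y \<in> \<Gamma> then cylinder n n x else {})" by auto
  then show ?case using card_cylinder_full[of n x] base by simp
next
  case (step j)
  have "fact (Suc j) * real (card {R \<in> cylinder n (Suc j) (x(Suc j := k)). R i \<in> \<Gamma>})
      = fact n * hit_prob n \<Gamma> (Suc j) (y + (if k \<le> y then 1 else 0))" if "k \<in> {1..Suc j}" for k
  proof (rule step.IH)
    \<comment> \<open>Fixing the newcomer's relative rank \<open>k\<close> makes the new rank of
      \<open>i\<close> constant on the subcylinder, as the induction hypothesis requires.\<close>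
    fix R assume "R \<in> cylinder n (Suc j) (x(Suc j := k))"
    then have R: "R \<in> cylinder n j x" "relative_rank (Suc j) R = k" by (auto simp: cylinder_Suc)
    then have "inj R" by (auto simp: cylinder_def dest: permutes_inj)
    from prefix_rank_Suc[OF this step.prems(1,2)] R step.prems(5)[OF R(1)]
    show "prefix_rank (Suc j) i R = y + (if k \<le> y then 1 else 0)" by simp
  qed (use step that in \<open>auto simp: le_Suc_eq\<close>)
  then have "fact (Suc j) * real (card {R \<in> cylinder n j x. R i \<in> \<Gamma>})
      = (\<Sum>k\<in>{1..Suc j}. fact n * hit_prob n \<Gamma> (Suc j) (y + (if k \<le> y then 1 else 0)))"
    unfolding card_cylinder_split[of n j x] of_nat_sum sum_distrib_left
    by (intro sum.cong) auto
  also have "\<dots> = fact n * (real (Suc j) * hit_prob n \<Gamma> j y)"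
    using step by (simp only: sum_distrib_left[symmetric] sum_shift_le hit_prob_step le_SucI)
  finally have "real (Suc j) * (fact j * real (card {R \<in> cylinder n j x. R i \<in> \<Gamma>}))
      = real (Suc j) * (fact n * hit_prob n \<Gamma> j y)"
    by (simp add: algebra_simps)
  then show ?case by (simp only: mult_cancel_left of_nat_eq_0_iff) simp
qed

lemma card_cylinder_hit_last:
  assumes "j < n" "\<And>k. k \<in> {1..Suc j} \<Longrightarrow> x k \<in> {1..k}"
  shows "fact (Suc j) * real (card {R \<in> cylinder n (Suc j) x. R (Suc j) \<in> \<Gamma>})
    = fact n * hit_prob n \<Gamma> (Suc j) (x (Suc j))"
  using assms assms(2)[of "Suc j"]
  by (intro card_cylinder_hit) (auto simp: cylinder_def relative_rank_eq_prefix_rank)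

text \<open>On each subcylinder an adapted rule either stops everywhere at \<open>Suc j\<close>,
  which yields \<open>hit_prob\<close>, or goes on everywhere, which yields at most the next
  \<open>stop_value\<close>. The maximum bounds both.\<close>

lemma card_cylinder_stop_le:
  assumes "j \<le> n"
    and "\<And>k. k \<in> {1..j} \<Longrightarrow> x k \<in> {1..k}"
    and "\<And>R. R permutes {1..n} \<Longrightarrow> \<tau> R \<le> n"
    and "\<And>R R' k. R permutes {1..n} \<Longrightarrow> R' permutes {1..n} \<Longrightarrow>
      (\<And>i. i \<in> {1..k} \<Longrightarrow> relative_rank i R = relative_rank i R') \<Longrightarrow> \<tau> R = k \<Longrightarrow> \<tau> R' = k"
    and "\<And>R. R \<in> cylinder n j x \<Longrightarrow> j < \<tau> R"
  shows "fact j * real (card {R \<in> cylinder n j x. R (\<tau> R) \<in> \<Gamma>}) \<le> fact n * stop_value n \<Gamma> j"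
  using assms
proof (induction j arbitrary: x rule: inc_induct)
  case base
  \<comment> \<open>No value of \<open>\<tau>\<close> lies strictly above \<open>n\<close>, so
    nothing is left at the last level.\<close>
  have "cylinder n n x = {}"
    using base(2,4) unfolding cylinder_def by fastforce
  then show ?case by simp
next
  case (step j)
  have "fact (Suc j) * real (card {R \<in> cylinder n (Suc j) (x(Suc j := k)). R (\<tau> R) \<in> \<Gamma>})
      \<le> fact n * max (hit_prob n \<Gamma> (Suc j) k) (stop_value n \<Gamma> (Suc j))" (is "?L \<le> _")
    if k: "k \<in> {1..Suc j}" for k
  proof -
    let ?x = "x(Suc j := k)"
    let ?C = "cylinder n (Suc j) ?x"
    have x: "?x i \<in> {1..i}" if "i \<in> {1..Suc j}" for i
      using that k step.prems(1)[of i] by (auto simp: le_Suc_eq)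
    show ?thesis
    proof (cases "\<exists>R\<in>?C. \<tau> R = Suc j")
      case True
      then obtain R where R: "R \<in> ?C" "\<tau> R = Suc j" by blast
      have "\<tau> R' = Suc j" if "R' \<in> ?C" for R'
        using step.prems(3)[OF _ _ _ R(2), of R'] R(1) that unfolding cylinder_def by simp
      then have "{R \<in> ?C. R (\<tau> R) \<in> \<Gamma>} = {R \<in> ?C. R (Suc j) \<in> \<Gamma>}" by auto
      then have "?L = fact n * hit_prob n \<Gamma> (Suc j) k"
        using card_cylinder_hit_last[OF step.hyps(2) x, of \<Gamma>] by (simp only: fun_upd_same)
      then show ?thesis by (simp add: mult_left_mono)
    next
      case False
      have "Suc j < \<tau> R" if "R \<in> ?C" for R
      proof -
        have "j < \<tau> R" using step.prems(4)[of R] that by (simp add: cylinder_Suc)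
        moreover have "\<tau> R \<noteq> Suc j" using False that by blast
        ultimately show ?thesis by simp
      qed
      then have "?L \<le> fact n * stop_value n \<Gamma> (Suc j)"
        using step.IH[of ?x] x step.prems(2,3) by blast
      then show ?thesis by (rule order_trans) (simp add: mult_left_mono)
    qed
  qed
  then have "fact (Suc j) * real (card {R \<in> cylinder n j x. R (\<tau> R) \<in> \<Gamma>})
      \<le> (\<Sum>k\<in>{1..Suc j}. fact n * max (hit_prob n \<Gamma> (Suc j) k) (stop_value n \<Gamma> (Suc j)))"
    unfolding card_cylinder_split[of n j x] of_nat_sum sum_distrib_left
    by (intro sum_mono) auto
  also have "\<dots> = fact n * (real (Suc j) * stop_value n \<Gamma> j)"
    by (simp only: sum_distrib_left[symmetric] stop_value_step[OF step.hyps(2)])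
  finally have "real (Suc j) * (fact j * real (card {R \<in> cylinder n j x. R (\<tau> R) \<in> \<Gamma>}))
      \<le> real (Suc j) * (fact n * stop_value n \<Gamma> j)"
    by (simp add: algebra_simps)
  then show ?case by (rule mult_left_le_imp_le) simp
qed

section \<open>An optimal rule: stop once stopping is at least as good as continuing\<close>

definition threshold_rule :: "nat \<Rightarrow> nat set \<Rightarrow> (nat \<Rightarrow> nat) \<Rightarrow> nat" where
  "threshold_rule n \<Gamma> R
    = (LEAST j. 1 \<le> j \<and> stop_value n \<Gamma> j \<le> hit_prob n \<Gamma> j (relative_rank j R))"

lemma threshold_rule:
  assumes "1 \<le> n"
  shows "1 \<le> threshold_rule n \<Gamma> R" "threshold_rule n \<Gamma> R \<le> n"
    "stop_value n \<Gamma> (threshold_rule n \<Gamma> R)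
      \<le> hit_prob n \<Gamma> (threshold_rule n \<Gamma> R) (relative_rank (threshold_rule n \<Gamma> R) R)"
proof -
  let ?Q = "\<lambda>j. 1 \<le> j \<and> stop_value n \<Gamma> j \<le> hit_prob n \<Gamma> j (relative_rank j R)"
  \<comment> \<open>The value of continuing after the last candidate is 0, which forces a stop at
    \<open>n\<close>.\<close>
  have n: "?Q n" using assms by simp
  show "threshold_rule n \<Gamma> R \<le> n" unfolding threshold_rule_def by (rule Least_le) (rule n)
  from LeastI[of ?Q n] n
  show "1 \<le> threshold_rule n \<Gamma> R" "stop_value n \<Gamma> (threshold_rule n \<Gamma> R)
      \<le> hit_prob n \<Gamma> (threshold_rule n \<Gamma> R) (relative_rank (threshold_rule n \<Gamma> R) R)"
    unfolding threshold_rule_def by auto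
qed

lemma threshold_rule_le:
  "1 \<le> j \<Longrightarrow> stop_value n \<Gamma> j \<le> hit_prob n \<Gamma> j (relative_rank j R) \<Longrightarrow> threshold_rule n \<Gamma> R \<le> j"
  unfolding threshold_rule_def by (rule Least_le) simp

text \<open>The recursion of the upper bound holds with equality, since on each subcylinder this
  rule takes the branch that attains the maximum.\<close>

lemma card_cylinder_threshold_rule:
  assumes "j \<le> n" "1 \<le> n"
    and "\<And>k. k \<in> {1..j} \<Longrightarrow> x k \<in> {1..k}"
    and "\<And>R. R \<in> cylinder n j x \<Longrightarrow> j < threshold_rule n \<Gamma> R"
  shows "fact j * real (card {R \<in> cylinder n j x. R (threshold_rule n \<Gamma> R) \<in> \<Gamma>})
    = fact n * stop_value n \<Gamma> j"
  using assms
proof (induction j arbitrary: x rule: inc_induct)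
  case base
  have "cylinder n n x = {}"
    using base(3) threshold_rule(2)[OF \<open>1 \<le> n\<close>, of \<Gamma>] by (meson equals0I leD)
  then show ?case by simp
next
  case (step j)
  let ?\<tau> = "threshold_rule n \<Gamma>"
  have "fact (Suc j) * real (card {R \<in> cylinder n (Suc j) (x(Suc j := k)). R (?\<tau> R) \<in> \<Gamma>})
      = fact n * max (hit_prob n \<Gamma> (Suc j) k) (stop_value n \<Gamma> (Suc j))" (is "?L = _")
    if k: "k \<in> {1..Suc j}" for k
  proof -
    let ?x = "x(Suc j := k)"
    let ?C = "cylinder n (Suc j) ?x"
    have x: "?x i \<in> {1..i}" if "i \<in> {1..Suc j}" for i
      using that k step.prems(2)[of i] by (auto simp: le_Suc_eq)
    have late: "Suc j \<le> ?\<tau> R" and rr: "relative_rank (Suc j) R = k" if "R \<in> ?C" for R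
      using that step.prems(3)[of R] by (auto simp: cylinder_Suc)
    show ?thesis
    proof (cases "stop_value n \<Gamma> (Suc j) \<le> hit_prob n \<Gamma> (Suc j) k")
      case True
      have "?\<tau> R = Suc j" if "R \<in> ?C" for R
        using threshold_rule_le[of "Suc j" n \<Gamma> R] late[OF that] rr[OF that] True by simp
      then have "{R \<in> ?C. R (?\<tau> R) \<in> \<Gamma>} = {R \<in> ?C. R (Suc j) \<in> \<Gamma>}" by auto
      then have "?L = fact n * hit_prob n \<Gamma> (Suc j) k"
        using card_cylinder_hit_last[OF step.hyps(2) x, of \<Gamma>] by (simp only: fun_upd_same)
      then show ?thesis using True by simp
    next
      case False
      have "Suc j < ?\<tau> R" if "R \<in> ?C" for R
      proof -
        have "?\<tau> R \<noteq> Suc j"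
          using False threshold_rule(3)[OF \<open>1 \<le> n\<close>, of \<Gamma> R] rr[OF that] by auto
        then show ?thesis using late[OF that] by simp
      qed
      then have "?L = fact n * stop_value n \<Gamma> (Suc j)"
        using step.IH[of ?x] x step.prems(1) by blast
      then show ?thesis using False by simp
    qed
  qed
  then have "fact (Suc j) * real (card {R \<in> cylinder n j x. R (?\<tau> R) \<in> \<Gamma>})
      = (\<Sum>k\<in>{1..Suc j}. fact n * max (hit_prob n \<Gamma> (Suc j) k) (stop_value n \<Gamma> (Suc j)))"
    unfolding card_cylinder_split[of n j x] of_nat_sum sum_distrib_left
    by (intro sum.cong) auto
  also have "\<dots> = fact n * (real (Suc j) * stop_value n \<Gamma> j)"
    by (simp only: sum_distrib_left[symmetric] stop_value_step[OF step.hyps(2)])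
  finally have "real (Suc j) * (fact j * real (card {R \<in> cylinder n j x. R (?\<tau> R) \<in> \<Gamma>}))
      = real (Suc j) * (fact n * stop_value n \<Gamma> j)"
    by (simp add: algebra_simps)
  then show ?case by (simp only: mult_cancel_left of_nat_eq_0_iff) simp
qed

section \<open>Passage from counting to the probability space and its stopping rules\<close>

lemma space_rank_space: "space (rank_space n) = {R. R permutes {1..n}}"
  by (simp add: rank_space_def space_uniform_count_measure)

lemma measure_rank_space:
  "measure (rank_space n) {R \<in> space (rank_space n). P R}
    = real (card {R. R permutes {1..n} \<and> P R}) / fact n"
proof -
  have "card {R. R permutes {1..n}} = fact n" by (rule card_permutations) auto
  then show ?thesis
    unfolding space_rank_space unfolding rank_space_def
    by (subst measure_uniform_count_measure) (auto simp: finite_permutations)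
qed

lemma sets_rank_filtration:
  "sets (rank_filtration n j) = sigma_sets (space (rank_space n))
     {relative_rank i -` A \<inter> space (rank_space n) | i A. i \<in> {1..j}}"
  unfolding rank_filtration_def by (rule sets_measure_of) auto

lemma space_rank_filtration: "space (rank_filtration n j) = space (rank_space n)"
  unfolding rank_filtration_def by (rule space_measure_of) auto

text \<open>The sets that do not separate \<open>R\<close> from \<open>R'\<close> contain the
  generators and are closed under complements and countable unions.\<close>

lemma rank_filtration_saturated:
  assumes A: "A \<in> sets (rank_filtration n j)"
    and R: "R permutes {1..n}" "R' permutes {1..n}"
    and eq: "\<And>i. i \<in> {1..j} \<Longrightarrow> relative_rank i R = relative_rank i R'"
  shows "R \<in> A \<longleftrightarrow> R' \<in> A"
  using A unfolding sets_rank_filtration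
proof (induction rule: sigma_sets.induct)
  case (Basic a)
  then show ?case using R eq by (auto simp: space_rank_space)
next
  case (Compl a)
  then show ?case using R by (auto simp: space_rank_space)
qed auto

lemma stopping_rule_adapted:
  assumes \<tau>: "\<tau> \<in> stopping_rules n"
    and R: "R permutes {1..n}" "R' permutes {1..n}"
    and eq: "\<And>i. i \<in> {1..k} \<Longrightarrow> relative_rank i R = relative_rank i R'"
    and k: "\<tau> R = k"
  shows "\<tau> R' = k"
proof -
  \<comment> \<open>The event \<open>\<tau> = k\<close> is the difference of
    \<open>\<tau> \<le> k\<close> and \<open>\<tau> \<le> k - 1\<close>, both decided by the first
    \<open>k\<close> relative ranks.\<close>
  have le_iff: "\<tau> R \<le> t \<longleftrightarrow> \<tau> R' \<le> t" if "t \<le> k" for t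
  proof -
    have "Measurable.pred (rank_filtration n t) (\<lambda>R. \<tau> R \<le> t)"
      using \<tau> by (auto simp: stopping_rules_def dest: stopping_timeD)
    then have "{R \<in> space (rank_space n). \<tau> R \<le> t} \<in> sets (rank_filtration n t)"
      by (simp add: pred_def space_rank_filtration)
    from rank_filtration_saturated[OF this R] that eq show ?thesis
      using R by (simp add: space_rank_space)
  qed
  show ?thesis
  proof (cases k)
    case 0
    then show ?thesis using le_iff[of 0] k by simp
  next
    case (Suc t)
    then show ?thesis using le_iff[of k] le_iff[of t] k by simp
  qed
qed

lemma threshold_rule_stopping:
  assumes "1 \<le> n"
  shows "threshold_rule n \<Gamma> \<in> stopping_rules n"
proof -
  have "Measurable.pred (rank_filtration n t) (\<lambda>R. threshold_rule n \<Gamma> R \<le> t)" for t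
  proof -
    let ?A = "\<lambda>i. relative_rank i -` {y. stop_value n \<Gamma> i \<le> hit_prob n \<Gamma> i y} \<inter> space (rank_space n)"
    \<comment> \<open>The rule has stopped by time \<open>t\<close> iff the stopping condition held
      at some time up to \<open>t\<close>.\<close>
    have "{R \<in> space (rank_space n). threshold_rule n \<Gamma> R \<le> t} = (\<Union>i\<in>{1..t}. ?A i)"
      using threshold_rule[OF assms, of \<Gamma>] threshold_rule_le[of _ n \<Gamma>]
      by (fastforce intro: order_trans)
    moreover have "?A i \<in> sets (rank_filtration n t)" if "i \<in> {1..t}" for i
      unfolding sets_rank_filtration using that by (intro sigma_sets.Basic) blast
    ultimately show ?thesis
      unfolding pred_def space_rank_filtration by (simp only: sets.finite_UN finite_atLeastAtMost)
  qed
  then show ?thesis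
    using threshold_rule(1,2)[OF assms] by (auto simp: stopping_rules_def intro!: stopping_timeI)
qed

lemma max_select_prob_eq_stop_value:
  assumes "1 \<le> n"
  shows "max_select_prob \<Gamma> n = stop_value n \<Gamma> 0"
proof -
  let ?p = "\<lambda>\<tau>. measure (rank_space n) {R \<in> space (rank_space n). R (\<tau> R) \<in> \<Gamma>}"
  \<comment> \<open>At level 0 no relative rank is prescribed, so \<open>id\<close> is only a
    placeholder.\<close>
  have p: "?p \<tau> = real (card {R \<in> cylinder n 0 id. R (\<tau> R) \<in> \<Gamma>}) / fact n" for \<tau>
    unfolding measure_rank_space by (simp add: cylinder_def)
  have "?p \<tau> \<le> stop_value n \<Gamma> 0" if \<tau>: "\<tau> \<in> stopping_rules n" for \<tau>
  proof -
    have range: "\<tau> R \<in> {1..n}" if "R permutes {1..n}" for R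
      using \<tau> that by (auto simp: stopping_rules_def space_rank_space)
    have "fact 0 * real (card {R \<in> cylinder n 0 id. R (\<tau> R) \<in> \<Gamma>}) \<le> fact n * stop_value n \<Gamma> 0"
    proof (rule card_cylinder_stop_le)
      show "\<tau> R' = k" if "R permutes {1..n}" "R' permutes {1..n}"
        "\<And>i. i \<in> {1..k} \<Longrightarrow> relative_rank i R = relative_rank i R'" "\<tau> R = k" for R R' k
        using stopping_rule_adapted[OF \<tau>] that by blast
      show "0 < \<tau> R" if "R \<in> cylinder n 0 id" for R
        using range[of R] that by (simp add: cylinder_def)
    qed (use range in auto)
    then show ?thesis unfolding p by (simp add: divide_le_eq mult.commute)
  qed
  moreover have "?p (threshold_rule n \<Gamma>) = stop_value n \<Gamma> 0"
    using card_cylinder_threshold_rule[of 0 n id \<Gamma>] threshold_rule(1)[OF assms, of \<Gamma>] assms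
    unfolding p by (simp add: Suc_le_eq)
  ultimately show ?thesis
    unfolding max_select_prob_def using threshold_rule_stopping[OF assms, of \<Gamma>]
    by (intro cSup_eq_maximum) (force intro: rev_image_eqI)+
qed

section \<open>Majorization and reversal\<close>

text \<open>The reflection of \<open>y\<close> to \<open>Suc j - y\<close> exchanges the two weights
  of the recursion, and at level \<open>n\<close> it is the reversal of
  \<open>\<Gamma>\<close>.\<close>

lemma hit_prob_reverse:
  assumes "j \<le> n" "1 \<le> y" "y \<le> j"
  shows "hit_prob n ((\<lambda>r. Suc n - r) ` (\<Gamma> \<inter> {1..n})) j y = hit_prob n \<Gamma> j (Suc j - y)"
  using assms
proof (induction j arbitrary: y rule: inc_induct)
  case base
  have "y \<in> (\<lambda>r. Suc n - r) ` (\<Gamma> \<inter> {1..n}) \<longleftrightarrow> Suc n - y \<in> \<Gamma>"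
    using base by (auto intro!: image_eqI[of _ _ "Suc n - y"])
  then show ?case by simp
next
  case (step j)
  let ?\<Gamma>' = "(\<lambda>r. Suc n - r) ` (\<Gamma> \<inter> {1..n})"
  \<comment> \<open>Level \<open>Suc j\<close> reflects about one more, so staying at
    \<open>y\<close> turns into a step up and conversely.\<close>
  have "hit_prob n ?\<Gamma>' (Suc j) y = hit_prob n \<Gamma> (Suc j) (Suc (Suc j - y))"
    "hit_prob n ?\<Gamma>' (Suc j) (Suc y) = hit_prob n \<Gamma> (Suc j) (Suc j - y)"
    using step.IH[of y] step.IH[of "Suc y"] step.prems by (auto simp: Suc_diff_le)
  then have "real (Suc j) * hit_prob n ?\<Gamma>' j y = real (Suc j) * hit_prob n \<Gamma> j (Suc j - y)"
    unfolding hit_prob_step[OF step.hyps(2)] using step.prems by (simp add: of_nat_diff)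
  then show ?case by (simp only: mult_cancel_left of_nat_eq_0_iff) simp
qed

lemma stop_value_reverse:
  assumes "j \<le> n"
  shows "stop_value n ((\<lambda>r. Suc n - r) ` (\<Gamma> \<inter> {1..n})) j = stop_value n \<Gamma> j"
  using assms
proof (induction j rule: inc_induct)
  case base
  then show ?case by simp
next
  case (step j)
  let ?\<Gamma>' = "(\<lambda>r. Suc n - r) ` (\<Gamma> \<inter> {1..n})"
  have "(\<Sum>y\<in>{1..Suc j}. max (hit_prob n ?\<Gamma>' (Suc j) y) (stop_value n ?\<Gamma>' (Suc j)))
      = (\<Sum>y\<in>{1..Suc j}. max (hit_prob n \<Gamma> (Suc j) (Suc (Suc j) - y)) (stop_value n \<Gamma> (Suc j)))"
    using step hit_prob_reverse[of "Suc j" n _ \<Gamma>] by (intro sum.cong) auto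
  also have "\<dots> = (\<Sum>y\<in>{1..Suc j}. max (hit_prob n \<Gamma> (Suc j) y) (stop_value n \<Gamma> (Suc j)))"
    by (rule sum.reindex_bij_witness[of _ "\<lambda>y. Suc (Suc j) - y" "\<lambda>y. Suc (Suc j) - y"]) auto
  finally have "real (Suc j) * stop_value n ?\<Gamma>' j = real (Suc j) * stop_value n \<Gamma> j"
    unfolding stop_value_step[OF step.hyps(2)] .
  then show ?case by (simp only: mult_cancel_left of_nat_eq_0_iff) simp
qed

section \<open>Majorization by the initial segment\<close>

lemma hit_prob_initial_antimono:
  assumes "j \<le> n" "1 \<le> y" "y < j"
  shows "hit_prob n {1..c} j (Suc y) \<le> hit_prob n {1..c} j y"
  using assms
proof (induction j arbitrary: y rule: inc_induct)
  case base
  then show ?case by simp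
next
  case (step j)
  let ?a = "hit_prob n {1..c} (Suc j)"
  \<comment> \<open>The right-hand side is \<open>Suc j\<close> times the drop from \<open>y\<close>
    to \<open>Suc y\<close> at level \<open>j\<close>, written through consecutive drops at level
    \<open>Suc j\<close>.\<close>
  have "0 \<le> (real (Suc j) - real y) * (?a y - ?a (Suc y)) + real (Suc y) * (?a (Suc y) - ?a (Suc (Suc y)))"
    using step.IH[of y] step.IH[of "Suc y"] step.prems by (intro add_nonneg_nonneg mult_nonneg_nonneg) auto
  then have "real (Suc j) * hit_prob n {1..c} j (Suc y) \<le> real (Suc j) * hit_prob n {1..c} j y"
    unfolding hit_prob_step[OF step.hyps(2)] by (simp add: algebra_simps)
  then show ?case by (rule mult_left_le_imp_le) simp
qed

text \<open>This is weak majorization only for \<open>a\<close> decreasing on \<open>{1..i}\<close>, so that \<open>sum a {1..m}\<close> is the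
  largest sum of \<open>m\<close> entries.\<close>

definition weakly_majorized :: "nat \<Rightarrow> (nat \<Rightarrow> real) \<Rightarrow> (nat \<Rightarrow> real) \<Rightarrow> bool" where
  "weakly_majorized i q a \<longleftrightarrow> (\<forall>S\<subseteq>{1..i}. sum q S \<le> sum a {1..card S})"

text \<open>Comparing \<open>q\<close> and \<open>a\<close> with the threshold \<open>a (Suc m)\<close> reduces the weighted sum to the sum over
  the single set of indices where \<open>q\<close> exceeds the threshold.\<close>

lemma weighted_sum_majorized:
  fixes q a w :: "nat \<Rightarrow> real"
  assumes maj: "weakly_majorized i q a"
    and anti: "\<And>k l. 1 \<le> k \<Longrightarrow> k \<le> l \<Longrightarrow> l \<le> i \<Longrightarrow> a l \<le> a k"
    and w: "\<And>z. z \<in> {1..i} \<Longrightarrow> 0 \<le> w z" "\<And>z. z \<in> {1..i} \<Longrightarrow> w z \<le> W" and "0 \<le> W"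
    and m: "m < i" and total: "sum w {1..i} = W * real m + r"
  shows "(\<Sum>z\<in>{1..i}. w z * q z) \<le> W * sum a {1..m} + r * a (Suc m)"
proof -
  define t where "t = a (Suc m)"
  define S where "S = {z \<in> {1..i}. t < q z}"
  have "S \<subseteq> {1..i}" by (auto simp: S_def)
  then have cS: "card S \<le> i" using card_mono[of "{1..i}" S] by simp
  \<comment> \<open>Weights are raised to \<open>W\<close> where \<open>q\<close> exceeds
    \<open>t\<close> and lowered to 0 elsewhere.\<close>
  have "(\<Sum>z\<in>{1..i}. w z * (q z - t)) \<le> (\<Sum>z\<in>{1..i}. if z \<in> S then W * (q z - t) else 0)"
    using w by (intro sum_mono) (auto simp: S_def mult_right_mono mult_nonneg_nonpos)
  also have "\<dots> = (\<Sum>z\<in>S. W * (q z - t))"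
    by (subst sum.If_cases) (auto simp: S_def intro!: sum.cong)
  also have "\<dots> = W * (sum q S - real (card S) * t)"
    by (simp add: sum_distrib_left[symmetric] sum_subtractf)
  also have "\<dots> \<le> W * (\<Sum>k\<in>{1..card S}. a k - t)"
    using maj \<open>S \<subseteq> {1..i}\<close> \<open>0 \<le> W\<close>
    by (intro mult_left_mono) (simp_all add: weakly_majorized_def sum_subtractf)
  also have "\<dots> \<le> W * (\<Sum>k\<in>{1..m}. a k - t)"
  proof (intro mult_left_mono \<open>0 \<le> W\<close>)
    have "(\<Sum>k\<in>{1..card S}. a k - t) = (\<Sum>k\<in>{1..i}. if k \<le> card S then a k - t else 0)"
      using cS by (intro sum.mono_neutral_cong_left) auto
    \<comment> \<open>As \<open>a\<close> decreases and \<open>t = a (Suc m)\<close>, the terms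
      \<open>a k - t\<close> are nonnegative up to \<open>m\<close> and nonpositive beyond.\<close>
    also have "\<dots> \<le> (\<Sum>k\<in>{1..i}. if k \<le> m then a k - t else 0)"
      using anti[of _ "Suc m"] anti[of "Suc m"] m unfolding t_def by (intro sum_mono) auto
    also have "\<dots> = (\<Sum>k\<in>{1..m}. a k - t)"
      using m by (intro sum.mono_neutral_cong_right) auto
    finally show "(\<Sum>k\<in>{1..card S}. a k - t) \<le> (\<Sum>k\<in>{1..m}. a k - t)" .
  qed
  also have "\<dots> = W * sum a {1..m} - W * real m * t" by (simp add: sum_subtractf algebra_simps)
  finally have "(\<Sum>z\<in>{1..i}. w z * (q z - t)) \<le> W * sum a {1..m} - W * real m * t" .
  moreover have "(\<Sum>z\<in>{1..i}. w z * (q z - t)) = (\<Sum>z\<in>{1..i}. w z * q z) - t * sum w {1..i}"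
    by (simp add: right_diff_distrib sum_subtractf sum_distrib_left mult.commute)
  ultimately show ?thesis unfolding total t_def by (simp add: algebra_simps)
qed

text \<open>The weights sum to \<open>j * card S + card S\<close> and are at most \<open>j\<close>, as required by
  \<open>weighted_sum_majorized\<close> with \<open>W = j\<close>.\<close>

lemma insertion_sum:
  fixes q :: "nat \<Rightarrow> real"
  assumes "S \<subseteq> {1..j}"
  shows "(\<Sum>y\<in>S. real y * q (Suc y) + (real (Suc j) - real y) * q y)
    = (\<Sum>z\<in>{1..Suc j}. ((if z - 1 \<in> S then real z - 1 else 0)
        + (if z \<in> S then real (Suc j) - real z else 0)) * q z)"
proof -
  have "(\<Sum>y\<in>S. real y * q (Suc y)) = (\<Sum>z\<in>Suc ` S. (real z - 1) * q z)"
    by (subst sum.reindex) auto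
  also have "Suc ` S = {z \<in> {1..Suc j}. z - 1 \<in> S}"
    using assms by (force simp: image_iff)
  also have "(\<Sum>z\<in>{z \<in> {1..Suc j}. z - 1 \<in> S}. (real z - 1) * q z)
      = (\<Sum>z\<in>{1..Suc j}. (if z - 1 \<in> S then real z - 1 else 0) * q z)"
    by (subst sum.inter_filter) (auto intro!: sum.cong)
  finally have 1: "(\<Sum>y\<in>S. real y * q (Suc y))
      = (\<Sum>z\<in>{1..Suc j}. (if z - 1 \<in> S then real z - 1 else 0) * q z)" .
  have "S = {z \<in> {1..Suc j}. z \<in> S}" using assms by auto
  then have "(\<Sum>y\<in>S. (real (Suc j) - real y) * q y)
      = (\<Sum>z\<in>{z \<in> {1..Suc j}. z \<in> S}. (real (Suc j) - real z) * q z)" by simp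
  also have "\<dots> = (\<Sum>z\<in>{1..Suc j}. (if z \<in> S then real (Suc j) - real z else 0) * q z)"
    by (subst sum.inter_filter) (auto intro!: sum.cong)
  finally show ?thesis using 1 by (simp only: sum.distrib distrib_right)
qed

text \<open>Position \<open>z \<le> m\<close> collects \<open>(z - 1) + (j + 1 - z) = j\<close>, and
  \<open>Suc m\<close> collects \<open>m\<close>: exactly the extremal weights in
  \<open>weighted_sum_majorized\<close> for \<open>W = j\<close> and \<open>r = m\<close>.\<close>

lemma initial_insertion_sum:
  fixes a :: "nat \<Rightarrow> real"
  shows "(\<Sum>y\<in>{1..m}. real y * a (Suc y) + (real (Suc j) - real y) * a y)
    = real j * sum a {1..m} + real m * a (Suc m)"
  by (induction m) (simp_all add: algebra_simps)

text \<open>At level \<open>n\<close> a set \<open>S\<close> meets \<open>\<Gamma>\<close> in at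
  most \<open>min (card S) c\<close> points. Going down a level, the weights spread from
  \<open>S\<close> give at most the extremal sum, which the initial segment attains.\<close>

lemma hit_prob_majorized:
  assumes "j \<le> n" "\<Gamma> \<subseteq> {1..n}" "card \<Gamma> = c"
  shows "weakly_majorized j (hit_prob n \<Gamma> j) (hit_prob n {1..c} j)"
  using assms(1)
proof (induction j rule: inc_induct)
  case base
  show ?case unfolding weakly_majorized_def
  proof (intro allI impI)
    fix S assume "S \<subseteq> {1..n}"
    then have fin: "finite S" "finite \<Gamma>" using assms(2) finite_subset by blast+
    have "sum (hit_prob n \<Gamma> n) S = real (card (S \<inter> \<Gamma>))"
      using fin by (simp add: sum.If_cases of_bool_def)
    also have "\<dots> \<le> real (min (card S) c)"
      using fin assms(3) card_mono[of S "S \<inter> \<Gamma>"] card_mono[of \<Gamma> "S \<inter> \<Gamma>"] by simp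
    also have "\<dots> = (\<Sum>y\<in>{1..card S}. of_bool (y \<in> {1..c}))"
      by (subst sum_of_bool_eq) (simp_all only: finite_atLeastAtMost Collect_mem_eq, simp)
    also have "\<dots> = sum (hit_prob n {1..c} n) {1..card S}"
      by (intro sum.cong) (simp_all only: hit_prob_final)
    finally show "sum (hit_prob n \<Gamma> n) S \<le> sum (hit_prob n {1..c} n) {1..card S}" .
  qed
next
  case (step j)
  let ?q = "hit_prob n \<Gamma> (Suc j)" and ?a = "hit_prob n {1..c} (Suc j)"
  have anti: "?a l \<le> ?a k" if "1 \<le> k" "k \<le> l" "l \<le> Suc j" for k l
    using that(2,1,3)
  proof (induction l rule: dec_induct)
    case (step l)
    have "?a (Suc l) \<le> ?a l"
      using step that(1) \<open>j < n\<close> by (intro hit_prob_initial_antimono) auto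
    with step.IH step.prems show ?case by simp
  qed simp
  show ?case unfolding weakly_majorized_def
  proof (intro allI impI)
    fix S assume S: "S \<subseteq> {1..j}"
    define w where "w z = (if z - 1 \<in> S then real z - 1 else 0)
      + (if z \<in> S then real (Suc j) - real z else 0)" for z
    have cS: "card S \<le> j" using card_mono[OF _ S] by simp
    have total: "sum w {1..Suc j} = real j * real (card S) + real (card S)"
      \<comment> \<open>For constant \<open>q = 1\<close> each \<open>y\<close> in \<open>S\<close>
        contributes \<open>y + (j + 1 - y) = j + 1\<close>.\<close>
      using insertion_sum[OF S, of "\<lambda>_. 1"] by (simp add: w_def algebra_simps)
    have "real (Suc j) * sum (hit_prob n \<Gamma> j) S = (\<Sum>z\<in>{1..Suc j}. w z * ?q z)"
      unfolding sum_distrib_left hit_prob_step[OF step.hyps(2)] insertion_sum[OF S] w_def ..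
    also have "\<dots> \<le> real j * sum ?a {1..card S} + real (card S) * ?a (Suc (card S))"
      using cS S by (intro weighted_sum_majorized[OF step.IH anti _ _ _ _ total]) (auto simp: w_def)
    also have "\<dots> = real (Suc j) * sum (hit_prob n {1..c} j) {1..card S}"
      unfolding sum_distrib_left hit_prob_step[OF step.hyps(2)] initial_insertion_sum ..
    finally show "sum (hit_prob n \<Gamma> j) S \<le> sum (hit_prob n {1..c} j) {1..card S}"
      by (rule mult_left_le_imp_le) simp
  qed
qed

text \<open>If \<open>S\<close> holds the indices with \<open>q y > v\<close>, the left side is
  \<open>sum q S\<close> plus \<open>i - card S\<close> copies of \<open>v\<close>. The first
  \<open>card S\<close> entries of \<open>a\<close> dominate the former, and copies of
  \<open>v'\<close> the latter.\<close>

lemma sum_max_majorized: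
  fixes q a :: "nat \<Rightarrow> real"
  assumes "weakly_majorized i q a" "v \<le> v'"
  shows "(\<Sum>y\<in>{1..i}. max (q y) v) \<le> (\<Sum>y\<in>{1..i}. max (a y) v')"
proof -
  define S where "S = {y \<in> {1..i}. v < q y}"
  have S: "S \<subseteq> {1..i}" by (auto simp: S_def)
  then have cS: "card S \<le> i" using card_mono[OF _ S] by simp
  have fin: "finite S" by (simp add: S_def)
  have "(\<Sum>y\<in>{1..i}. max (q y) v) = (\<Sum>y\<in>{1..i} - S. max (q y) v) + (\<Sum>y\<in>S. max (q y) v)"
    using S by (intro sum.subset_diff) auto
  also have "(\<Sum>y\<in>{1..i} - S. max (q y) v) = real (i - card S) * v"
  proof -
    have "(\<Sum>y\<in>{1..i} - S. max (q y) v) = (\<Sum>y\<in>{1..i} - S. v)"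
      by (intro sum.cong) (auto simp: S_def)
    then show ?thesis using S fin by (simp add: card_Diff_subset)
  qed
  also have "(\<Sum>y\<in>S. max (q y) v) = sum q S"
    by (intro sum.cong) (auto simp: S_def)
  also have "sum q S \<le> sum a {1..card S}"
    using assms(1) S by (simp add: weakly_majorized_def)
  also have "real (i - card S) * v \<le> (\<Sum>y\<in>{card S<..i}. v')"
    using assms(2) by (simp add: mult_left_mono)
  also have "(\<Sum>y\<in>{card S<..i}. v') + sum a {1..card S}
      \<le> (\<Sum>y\<in>{card S<..i}. max (a y) v') + (\<Sum>y\<in>{1..card S}. max (a y) v')"
    by (intro add_mono sum_mono) auto
  also have "\<dots> = (\<Sum>y\<in>{card S<..i} \<union> {1..card S}. max (a y) v')"
    by (subst sum.union_disjoint) auto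
  also have "{card S<..i} \<union> {1..card S} = {1..i}" using cS by auto
  finally show ?thesis by simp
qed

lemma stop_value_le_initial:
  assumes "j \<le> n" "\<Gamma> \<subseteq> {1..n}" "card \<Gamma> = c"
  shows "stop_value n \<Gamma> j \<le> stop_value n {1..c} j"
  using assms(1)
proof (induction j rule: inc_induct)
  case base
  then show ?case by simp
next
  case (step j)
  have "real (Suc j) * stop_value n \<Gamma> j \<le> real (Suc j) * stop_value n {1..c} j"
    unfolding stop_value_step[OF step.hyps(2)]
    using step assms by (intro sum_max_majorized hit_prob_majorized) auto
  then show ?case by (rule mult_left_le_imp_le) simp
qed

theorem theorem3p3:
  fixes c n :: nat and \<Gamma> :: "nat set"
  assumes "1 \<le> c" and "c < n"
    and "\<Gamma> \<subseteq> {1..n}" and "card \<Gamma> = c"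
  shows "max_select_prob \<Gamma> n \<le> max_select_prob {1..c} n
    \<and> max_select_prob {1..c} n = max_select_prob {n - c + 1..n} n"
proof -
  have n: "1 \<le> n" using assms by simp
  have "(\<lambda>r. Suc n - r) ` ({1..c} \<inter> {1..n}) = {n - c + 1..n}"
  proof (intro equalityI subsetI)
    fix y assume "y \<in> {n - c + 1..n}"
    then show "y \<in> (\<lambda>r. Suc n - r) ` ({1..c} \<inter> {1..n})"
      using assms by (intro image_eqI[of _ _ "Suc n - y"]) auto
  qed (use assms in auto)
  \<comment> \<open>Reversal maps the \<open>c\<close> best ranks to the \<open>c\<close> worst and
    preserves the value.\<close>
  then have "stop_value n {n - c + 1..n} 0 = stop_value n {1..c} 0"
    using stop_value_reverse[of 0 n "{1..c}"] by simp
  then show ?thesis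
    unfolding max_select_prob_eq_stop_value[OF n]
    using stop_value_le_initial[of 0 n \<Gamma> c] assms by simp
qed

end
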